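(* Let $E$ be a Banach space, let $(x_{0,n},g_n)_{n\ge1}$ be a sequence in $E\times C^0_b(E,E)$ with each $g_n$ a complete vector field, and let $x_n\in C^1([0,+\infty),E)$ be the unique solution of $\dot x_n(t)=g_n(x_n(t))$, $t\ge0$, $x_n(0)=x_{0,n}$. Assume that $(x_{0,n},g_n)\to(x_0,g)$ in $E\times C^0_b(E,E)$ as $n\to\infty$ with $g$ complete, and let $x$ be the unique solution of $\dot x(t)=g(x(t))$, $x(0)=x_0$. Suppose there exists a Banach space $\mathcal E$ such that $E\subset\mathcal E$ densely, $\|v\|_{\mathcal E}\le\|v\|_E$ for all $v\in E$, $g\in C^1_{\mathcal E}(E,E)$, and $$\big(\sqrt n(x_{0,n}-x_0),\ \sqrt n(g_n-g)\big)\to(y_0,h)\quad\text{in }\mathcal E\times C^0_b(E,\mathcal E)\text{ as }n\to\infty.$$ Then $y_n:=\sqrt n(x_n-x)$ converges in $C^1([0,+\infty),\mathcal E)$ to the unique solution $y$ of the linear differential equation in $\mathcal E$ $$\dot y(t)=(\mathrm d_{x(t)}g)(y(t))+h(x(t)),\qquad t\ge0,\qquad y(0)=y_0.$$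
   Context: For Banach spaces $E,E'$, $C^0_b(E,E')$ is the space of continuous maps $E\to E'$ that are bounded on bounded subsets, with the topology of uniform convergence on bounded sets. $C^1([0,+\infty),E)$ is the space of continuously differentiable functions $[0,+\infty)\to E$ with uniform convergence of functions and derivatives on bounded time sets. A vector field (continuous map $g:E\to E$) is complete if it is locally Lipschitz and the Cauchy problem $\dot x=g(x)$, $x(0)=x_0$ has a unique global solution on $[0,\infty)$ for every $x_0\in E$. $C^1_{\mathcal E}(E,E)$ is the class of functions $f:E\to E$ that are Fréchet differentiable on $E$ and such that: (i) for every $x\in E$, the derivative $\mathrm d_xf:(E,\|\cdot\|_{\mathcal E})\to(E,\|\cdot\|_{\mathcal E})$ is linear and continuous; (ii) the map $x\mapsto\mathrm d_xf$ is continuous from $(E,\|\cdot\|_E)$ to the space of continuous linear operators $(E,\|\cdot\|_{\mathcal E})\to(E,\|\cdot\|_{\mathcal E})$ with the operator norm. By density, each $\mathrm d_xf$ extends uniquely to a continuous linear operator on $\mathcal E$, still denoted $\mathrm d_xf$. *)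

theory Defs
  imports "HOL-Analysis.Analysis"
begin

definition C0b :: "('a::real_normed_vector \<Rightarrow> 'b::real_normed_vector) set" where
  "C0b = {f. continuous_on UNIV f \<and> (\<forall>B. bounded B \<longrightarrow> bounded (f ` B))}"

definition C0b_tendsto ::
  "(nat \<Rightarrow> 'a::real_normed_vector \<Rightarrow> 'b::real_normed_vector) \<Rightarrow> ('a \<Rightarrow> 'b) \<Rightarrow> bool" where
  "C0b_tendsto F f \<longleftrightarrow> (\<forall>B. bounded B \<longrightarrow> uniform_limit B F f sequentially)"

text \<open>A function on $[0,+\infty)$ is represented by a total function on the reals of which only
  the values on \<open>{0..}\<close> matter. The derivative at \<open>0\<close> is the one-sided one.\<close>

definition C1_halfline :: "(real \<Rightarrow> 'a::real_normed_vector) set" where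
  "C1_halfline = {u. u differentiable_on {0..} \<and>
     continuous_on {0..} (\<lambda>t. vector_derivative u (at t within {0..}))}"

definition C1_tendsto ::
  "(nat \<Rightarrow> real \<Rightarrow> 'a::real_normed_vector) \<Rightarrow> (real \<Rightarrow> 'a) \<Rightarrow> bool" where
  "C1_tendsto U u \<longleftrightarrow> (\<forall>B. bounded B \<and> B \<subseteq> {0..} \<longrightarrow>
     uniform_limit B U u sequentially \<and>
     uniform_limit B (\<lambda>n t. vector_derivative (U n) (at t within {0..}))
       (\<lambda>t. vector_derivative u (at t within {0..})) sequentially)"

definition cauchy_solution ::
  "(real \<Rightarrow> 'a \<Rightarrow> 'a) \<Rightarrow> 'a \<Rightarrow> (real \<Rightarrow> 'a::real_normed_vector) \<Rightarrow> bool" where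
  "cauchy_solution F u0 u \<longleftrightarrow> u 0 = u0 \<and>
     (\<forall>t\<ge>0. (u has_vector_derivative F t (u t)) (at t within {0..}))"

definition unique_cauchy_solution ::
  "(real \<Rightarrow> 'a \<Rightarrow> 'a) \<Rightarrow> 'a \<Rightarrow> (real \<Rightarrow> 'a::real_normed_vector) \<Rightarrow> bool" where
  "unique_cauchy_solution F u0 u \<longleftrightarrow> cauchy_solution F u0 u \<and>
     (\<forall>w. cauchy_solution F u0 w \<longrightarrow> (\<forall>t\<ge>0. w t = u t))"

definition complete_vector_field :: "('a::real_normed_vector \<Rightarrow> 'a) \<Rightarrow> bool" where
  "complete_vector_field g \<longleftrightarrow> continuous_on UNIV g \<and>
     local_lipschitz (UNIV :: real set) UNIV (\<lambda>_. g) \<and>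
     (\<forall>u0. \<exists>u. unique_cauchy_solution (\<lambda>_. g) u0 u)"

text \<open>The inclusion of $E$ into the larger space $\mathcal{E}$ is rendered by an injective linear
  map \<open>j\<close>; the norm $\|v\|_{\mathcal{E}}$ of an element \<open>v\<close> of $E$ is then \<open>norm (j v)\<close>.\<close>

definition dense_inclusion :: "('e::real_normed_vector \<Rightarrow> 'f::real_normed_vector) \<Rightarrow> bool" where
  "dense_inclusion j \<longleftrightarrow> linear j \<and> inj j \<and> closure (range j) = UNIV \<and>
     (\<forall>v. norm (j v) \<le> norm v)"

text \<open>The next two definitions are \<^const>\<open>bounded_linear\<close> and \<^const>\<open>onorm\<close> for operators from
  $(E, \|\cdot\|_{\mathcal{E}})$ to itself.\<close>

definition bounded_linear_wrt ::
  "('e::real_normed_vector \<Rightarrow> 'f::real_normed_vector) \<Rightarrow> ('e \<Rightarrow> 'e) \<Rightarrow> bool" where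
  "bounded_linear_wrt j T \<longleftrightarrow> linear T \<and> (\<exists>K. \<forall>v. norm (j (T v)) \<le> norm (j v) * K)"

definition onorm_wrt ::
  "('e::real_normed_vector \<Rightarrow> 'f::real_normed_vector) \<Rightarrow> ('e \<Rightarrow> 'e) \<Rightarrow> real" where
  "onorm_wrt j T = (SUP v. norm (j (T v)) / norm (j v))"

definition C1_wrt ::
  "('e::real_normed_vector \<Rightarrow> 'f::real_normed_vector) \<Rightarrow> ('e \<Rightarrow> 'e) set" where
  "C1_wrt j = {f. (\<forall>x. f differentiable (at x)) \<and>
     (\<forall>x. bounded_linear_wrt j (frechet_derivative f (at x))) \<and>
     (\<forall>x. ((\<lambda>z. onorm_wrt j (\<lambda>v. frechet_derivative f (at z) v - frechet_derivative f (at x) v))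
        \<longlongrightarrow> 0) (at x))}"

text \<open>The description below determines a unique operator when \<open>j\<close> is a dense inclusion into a
  Banach space and \<open>T\<close> satisfies \<open>bounded_linear_wrt j T\<close>.\<close>

definition extension_wrt ::
  "('e::real_normed_vector \<Rightarrow> 'f::real_normed_vector) \<Rightarrow> ('e \<Rightarrow> 'e) \<Rightarrow> ('f \<Rightarrow> 'f)" where
  "extension_wrt j T = (THE L. bounded_linear L \<and> (\<forall>v. L (j v) = j (T v)))"

end

theory Submission
  imports Defs
begin

text \<open>
  The rescaled difference \<open>Y n = \<surd>n (X n - x)\<close>, viewed in the larger space, satisfies
  \<open>Y n' = \<surd>n (G n (X n) - g (X n)) + \<surd>n (g (X n) - g x)\<close>. If \<open>X n \<rightarrow> x\<close> locally uniformly in the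
  smaller space, then the first term tends to \<open>h x\<close>, and a first-order Taylor expansion turns the
  second one into \<open>D x (Y n)\<close> up to an error that is small compared with the norm of \<open>Y n\<close>; here
  \<open>D\<close> is the derivative of \<open>g\<close>, extended to the larger space. So \<open>Y n\<close> solves the linear equation
  \<open>y' = D x y + h x\<close> up to a residual that tends to zero relative to \<open>1 + \<parallel>Y n\<parallel>\<close>.

  A Gronwall estimate (\<open>gronwall_norm\<close>) does the rest. It bounds the \<open>Y n\<close>, which makes the
  residual uniformly small, and then shows that they form a Cauchy sequence, uniformly on bounded
  time intervals. The limit of the \<open>Y n\<close> and of their derivatives is a solution of the linear
  equation, so existence comes from completeness together with convergence, without a separate
  Picard iteration (\<open>approximate_solutions_converge\<close>); uniqueness is Gronwall again.

  In infinite dimension, continuity of \<open>h\<close> and \<open>D\<close> and local Lipschitz continuity of \<open>g\<close> need not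
  be uniform on bounded sets. They are uniform near the compact set \<open>x ` {0..T}\<close>
  (\<open>uniform_near_compact\<close>), and this is what the convergence of \<open>X n\<close>
  (\<open>flow_depends_continuously_on_field\<close>) and the estimate of the residual rest on. The norm of the
  smaller space controls how far \<open>X n\<close> is from \<open>x\<close>, hence how much \<open>D\<close> varies between them; the
  weaker norm measures the Taylor remainder itself (\<open>taylor_remainder_wrt\<close>).
\<close>

section \<open>Differential inequalities on the half-line\<close>

text \<open>
  At the first time \<open>\<tau>\<close> at which the norm reached the barrier, the mean value inequality on
  \<open>{0..\<tau>}\<close> would give \<open>norm (u \<tau>) \<le> norm (u 0) + \<phi> \<tau> - \<phi> 0 < \<phi> \<tau>\<close>. This comparison never
  differentiates the norm, and it asks for the bound on \<open>u'\<close> only as long as \<open>u\<close> is below the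
  barrier.
\<close>
lemma norm_stays_below_barrier:
  fixes u :: "real \<Rightarrow> 'a::real_normed_vector" and \<phi> :: "real \<Rightarrow> real"
  assumes u: "\<And>t. t \<in> {0..T} \<Longrightarrow> (u has_vector_derivative u' t) (at t within {0..})"
    and \<phi>: "\<And>t. (\<phi> has_real_derivative \<phi>' t) (at t)"
    and init: "norm (u 0) < \<phi> 0"
    and step: "\<And>t. t \<in> {0..T} \<Longrightarrow> norm (u t) < \<phi> t \<Longrightarrow> norm (u' t) \<le> \<phi>' t"
    and t: "t \<in> {0..T}"
  shows "norm (u t) < \<phi> t"
proof (rule ccontr)
  assume neg: "\<not> norm (u t) < \<phi> t"
  have cu: "continuous_on {0..t} u"
    unfolding continuous_on_eq_continuous_within
  proof
    fix s assume "s \<in> {0..t}"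
    then have "continuous (at s within {0..}) u"
      using u[of s] t by (intro has_vector_derivative_continuous) auto
    then show "continuous (at s within {0..t}) u"
      by (rule continuous_within_subset) auto
  qed
  have c\<phi>: "continuous_on A \<phi>" for A
    by (meson DERIV_isCont \<phi> continuous_at_imp_continuous_on)
  define S where "S = {0..t} \<inter> (\<lambda>s. norm (u s) - \<phi> s) -` {0..}"
  have "closed S"
    unfolding S_def by (intro continuous_closed_preimage continuous_intros cu c\<phi>)
  moreover have "S \<noteq> {}"
    using neg t unfolding S_def by auto
  moreover have "bdd_below S"
    by (rule bdd_belowI[of _ 0]) (auto simp: S_def)
  ultimately have \<tau>: "Inf S \<in> S"
    by (rule closed_contains_Inf[rotated 2])
  define \<tau> where "\<tau> = Inf S"
  have \<tau>_le: "\<tau> \<le> t" "0 \<le> \<tau>" "\<phi> \<tau> \<le> norm (u \<tau>)"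
    using \<tau> unfolding \<tau>_def by (auto simp: S_def)
  have below: "norm (u s) < \<phi> s" if "0 \<le> s" "s < \<tau>" for s
  proof (rule ccontr)
    assume "\<not> norm (u s) < \<phi> s"
    then have "s \<in> S" using that \<tau>_le by (auto simp: S_def)
    then have "\<tau> \<le> s" unfolding \<tau>_def by (rule cInf_lower) fact
    then show False using that by simp
  qed
  have "0 < \<tau>"
    using \<tau>_le init by (cases "\<tau> = 0") auto
  have "norm (u \<tau> - u 0) \<le> \<phi> \<tau> - \<phi> 0"
  proof (rule differentiable_bound_general[OF \<open>0 < \<tau>\<close>, where f'=u' and \<phi>'=\<phi>'])
    show "continuous_on {0..\<tau>} u"
      using cu by (rule continuous_on_subset) (use \<tau>_le in auto)
    fix s assume s: "0 < s" "s < \<tau>"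
    then have "at s within {0..} = at s"
      by (intro at_within_interior) auto
    then show "(u has_vector_derivative u' s) (at s)"
      using u[of s] s \<tau>_le t by auto
    show "(\<phi> has_vector_derivative \<phi>' s) (at s)"
      using \<phi> by (simp add: has_real_derivative_iff_has_vector_derivative)
    show "norm (u' s) \<le> \<phi>' s"
      using step below s \<tau>_le t by auto
  qed (rule c\<phi>)
  moreover have "norm (u \<tau>) \<le> norm (u \<tau> - u 0) + norm (u 0)"
    by (metis add.commute norm_triangle_sub)
  ultimately show False using \<tau>_le init by linarith
qed

text \<open>
  The barrier is \<open>\<lambda>t. (r + b * t) * exp (a * t)\<close>, whose derivative dominates \<open>a\<close> times itself
  plus \<open>b\<close>. The differential inequality is needed only while \<open>u\<close> obeys the final bound, so an
  estimate that is valid just in a small neighbourhood can be used, provided that the final bound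
  keeps \<open>u\<close> inside it.
\<close>
lemma gronwall_norm:
  fixes u :: "real \<Rightarrow> 'a::real_normed_vector"
  assumes u: "\<And>t. t \<in> {0..T} \<Longrightarrow> (u has_vector_derivative u' t) (at t within {0..})"
    and ab: "0 \<le> a" "0 \<le> b" and init: "norm (u 0) < r"
    and le: "\<And>t. t \<in> {0..T} \<Longrightarrow> norm (u t) < (r + b * T) * exp (a * T) \<Longrightarrow>
               norm (u' t) \<le> a * norm (u t) + b"
    and t: "t \<in> {0..T}"
  shows "norm (u t) < (r + b * T) * exp (a * T)"
proof -
  define \<phi> where "\<phi> = (\<lambda>t. (r + b * t) * exp (a * t))"
  have r: "0 < r" using init norm_ge_zero[of "u 0"] by linarith
  have mono: "\<phi> s \<le> (r + b * T) * exp (a * T)" if "s \<in> {0..T}" for s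
    unfolding \<phi>_def using that ab r by (intro mult_mono add_mono) (auto simp: mult_left_mono)
  have "norm (u t) < \<phi> t"
  proof (rule norm_stays_below_barrier[OF u _ _ _ t, where \<phi>'="\<lambda>t. a * \<phi> t + b * exp (a * t)"])
    fix s
    show "(\<phi> has_real_derivative a * \<phi> s + b * exp (a * s)) (at s)"
      unfolding \<phi>_def by (auto intro!: derivative_eq_intros simp: algebra_simps)
    assume s: "s \<in> {0..T}" "norm (u s) < \<phi> s"
    have "norm (u' s) \<le> a * norm (u s) + b"
      using le[OF s(1)] s mono[OF s(1)] by simp
    also have "\<dots> \<le> a * \<phi> s + b * exp (a * s)"
      using s ab by (intro add_mono mult_left_mono) (auto simp: mult_le_cancel_left1)
    finally show "norm (u' s) \<le> a * \<phi> s + b * exp (a * s)" .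
  qed (use init in \<open>auto simp: \<phi>_def\<close>)
  then show ?thesis using mono[OF t] by simp
qed

section \<open>Uniformity near compact sets\<close>

text \<open>
  In infinite dimension a closed neighbourhood of a compact set is not compact, so only the first
  point of the pair ranges over a compact set; the second one is merely close to it. The index \<open>n\<close> stands for a constant, such as a Lipschitz
  constant, that may have to grow. If the claim failed for every \<open>n\<close> at distance
  \<open>inverse (Suc n)\<close>, a limit point of the offending points of \<open>K\<close> would violate the local property.
\<close>
lemma uniform_near_compact:
  fixes K :: "'a::metric_space set" and Q :: "nat \<Rightarrow> 'a \<Rightarrow> 'a \<Rightarrow> bool"
  assumes K: "compact K"
    and loc: "\<And>a. a \<in> K \<Longrightarrow> \<exists>r>0. \<exists>n. \<forall>b\<in>ball a r. \<forall>c\<in>ball a r. Q n b c"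
    and mono: "\<And>m n b c. m \<le> n \<Longrightarrow> Q m b c \<Longrightarrow> Q n b c"
  obtains \<delta> n where "\<delta> > 0" "\<And>a c. a \<in> K \<Longrightarrow> dist a c < \<delta> \<Longrightarrow> Q n a c"
proof -
  have "\<exists>n. \<forall>a\<in>K. \<forall>c. dist a c < inverse (real (Suc n)) \<longrightarrow> Q n a c"
  proof (rule ccontr)
    assume "\<not> ?thesis"
    then have "\<forall>n. \<exists>a c. a \<in> K \<and> dist a c < inverse (real (Suc n)) \<and> \<not> Q n a c"
      by blast
    then obtain a c where ac: "\<And>n. a n \<in> K" "\<And>n. dist (a n) (c n) < inverse (real (Suc n))"
      "\<And>n. \<not> Q n (a n) (c n)"
      by metis
    obtain l s where l: "l \<in> K" "strict_mono (s :: nat \<Rightarrow> nat)" "(a \<circ> s) \<longlonglongrightarrow> l"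
      using K ac(1) unfolding compact_def by blast
    from loc[OF l(1)] obtain r N where r: "r > 0" and Q: "\<forall>b\<in>ball l r. \<forall>c\<in>ball l r. Q N b c"
      by blast
    have "\<forall>\<^sub>F n in sequentially. dist (a (s n)) l < r / 2"
      using tendstoD[OF l(3), of "r / 2"] r by (simp add: o_def)
    moreover have "\<forall>\<^sub>F n in sequentially. inverse (real (Suc n)) < r / 2"
      using LIMSEQ_inverse_real_of_nat r by (intro order_tendstoD) auto
    ultimately have "\<forall>\<^sub>F n in sequentially. dist (a (s n)) l < r / 2 \<and> inverse (real (Suc n)) < r / 2 \<and> N \<le> n"
      using eventually_ge_at_top[of N] by eventually_elim auto
    then obtain n where n: "dist (a (s n)) l < r / 2" "inverse (real (Suc n)) < r / 2" "N \<le> n"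
      using eventually_happens'[OF sequentially_bot] by blast
    have sn: "n \<le> s n" using l(2) by (rule strict_mono_imp_increasing)
    have "inverse (real (Suc (s n))) \<le> inverse (real (Suc n))"
      using sn by (intro le_imp_inverse_le) auto
    then have "dist (a (s n)) (c (s n)) < r / 2"
      using ac(2)[of "s n"] n(2) by linarith
    then have "a (s n) \<in> ball l r" "c (s n) \<in> ball l r"
      using n(1) r dist_triangle[of l "c (s n)" "a (s n)"] by (auto simp: dist_commute)
    then have "Q N (a (s n)) (c (s n))" using Q by blast
    then show False using mono[of N "s n"] ac(3) n(3) sn by (meson order_trans)
  qed
  then obtain n where n: "\<forall>a\<in>K. \<forall>c. dist a c < inverse (real (Suc n)) \<longrightarrow> Q n a c" ..
  show thesis by (rule that[of "inverse (real (Suc n))" n]) (use n in auto)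
qed

lemma continuous_uniform_near_compact:
  fixes f :: "'a::metric_space \<Rightarrow> 'b::metric_space"
  assumes "compact K" and f: "continuous_on UNIV f" and "\<epsilon> > 0"
  shows "\<exists>\<delta>>0. \<forall>a\<in>K. \<forall>c. dist a c < \<delta> \<longrightarrow> dist (f a) (f c) < \<epsilon>"
proof (rule uniform_near_compact[OF \<open>compact K\<close>, where Q="\<lambda>_ a c. dist (f a) (f c) < \<epsilon>"])
  fix a
  have "\<exists>r>0. \<forall>b. dist b a < r \<longrightarrow> dist (f b) (f a) < \<epsilon> / 2"
    using f half_gt_zero[OF \<open>\<epsilon> > 0\<close>] unfolding continuous_on_iff by blast
  then obtain r where r: "r > 0" "\<forall>b. dist b a < r \<longrightarrow> dist (f b) (f a) < \<epsilon> / 2"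
    by blast
  have "dist (f b) (f c) < \<epsilon>" if bc: "b \<in> ball a r" "c \<in> ball a r" for b c
  proof (rule dist_triangle_half_l[of _ "f a"])
    show "dist (f b) (f a) < \<epsilon> / 2" "dist (f c) (f a) < \<epsilon> / 2"
      using r(2) bc by (metis dist_commute mem_ball)+
  qed
  then show "\<exists>r>0. \<exists>n::nat. \<forall>b\<in>ball a r. \<forall>c\<in>ball a r. dist (f b) (f c) < \<epsilon>"
    using r(1) by blast
next
  fix \<delta> :: real
  assume "0 < \<delta>" "\<And>a c. a \<in> K \<Longrightarrow> dist a c < \<delta> \<Longrightarrow> dist (f a) (f c) < \<epsilon>"
  then show ?thesis by blast
qed

lemma lipschitz_near_compact:
  fixes g :: "'a::metric_space \<Rightarrow> 'b::metric_space"
  assumes "compact K" and g: "local_lipschitz (UNIV :: real set) UNIV (\<lambda>_. g)"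
  obtains \<delta> L where "\<delta> > 0" "L \<ge> 0"
    "\<And>a c. a \<in> K \<Longrightarrow> dist a c < \<delta> \<Longrightarrow> dist (g a) (g c) \<le> L * dist a c"
proof (rule uniform_near_compact[OF \<open>compact K\<close>, where Q="\<lambda>n a c. dist (g a) (g c) \<le> real n * dist a c"])
  fix a
  obtain r L where r: "r > 0" and L: "L-lipschitz_on (cball a r) g"
    using local_lipschitzE[OF g, of 0 a] by (metis Int_UNIV_right UNIV_I centre_in_cball less_imp_le)
  obtain n :: nat where n: "L \<le> real n" using real_arch_simple by blast
  have "dist (g b) (g c) \<le> real n * dist b c" if "b \<in> ball a r" "c \<in> ball a r" for b c
  proof -
    have "dist (g b) (g c) \<le> L * dist b c"
      using that by (intro lipschitz_onD[OF L]) auto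
    also have "\<dots> \<le> real n * dist b c"
      using n by (intro mult_right_mono) auto
    finally show ?thesis .
  qed
  then show "\<exists>r>0. \<exists>n. \<forall>b\<in>ball a r. \<forall>c\<in>ball a r. dist (g b) (g c) \<le> real n * dist b c"
    using r by blast
next
  fix m n :: nat and b c assume "m \<le> n" "dist (g b) (g c) \<le> real m * dist b c"
  moreover have "real m * dist b c \<le> real n * dist b c"
    using \<open>m \<le> n\<close> by (intro mult_right_mono) auto
  ultimately show "dist (g b) (g c) \<le> real n * dist b c" by linarith
next
  fix \<delta> :: real and n :: nat
  assume "0 < \<delta>" "\<And>a c. a \<in> K \<Longrightarrow> dist a c < \<delta> \<Longrightarrow> dist (g a) (g c) \<le> real n * dist a c"
  then show thesis by (intro that[of \<delta> "real n"]) auto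
qed

section \<open>Continuous dependence of the flow on the vector field\<close>

lemma cauchy_solution_continuous_on:
  assumes "cauchy_solution F u0 u"
  shows "continuous_on {0..} u"
  using assms unfolding cauchy_solution_def
  by (auto simp: continuous_on_eq_continuous_within intro: has_vector_derivative_continuous)

lemma cauchy_solution_compact_trajectory:
  assumes "cauchy_solution F u0 u"
  shows "compact (u ` {0..T})"
  by (intro compact_continuous_image continuous_on_subset[OF cauchy_solution_continuous_on[OF assms]]) auto

text \<open>
  Near the compact trajectory of \<open>x\<close> the field \<open>g\<close> has a Lipschitz constant \<open>L\<close>, and there
  \<open>G n\<close> is uniformly close to \<open>g\<close>. Gronwall's estimate thus applies as long as \<open>X n\<close> remains
  near that trajectory, and for large \<open>n\<close> its conclusion says that \<open>X n\<close> never leaves.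
\<close>
lemma flow_depends_continuously_on_field:
  fixes x :: "real \<Rightarrow> 'e::real_normed_vector"
  assumes X: "\<And>n. n \<ge> 1 \<Longrightarrow> cauchy_solution (\<lambda>_. G n) (X0 n) (X n)"
    and x: "cauchy_solution (\<lambda>_. g) x0 x"
    and X0: "X0 \<longlonglongrightarrow> x0" and G: "C0b_tendsto G g"
    and lip: "local_lipschitz (UNIV :: real set) UNIV (\<lambda>_. g)"
  shows "uniform_limit {0..T} X x sequentially"
proof (cases "T \<ge> 0")
  case T: True
  define K where "K = x ` {0..T}"
  have K: "compact K"
    unfolding K_def by (rule cauchy_solution_compact_trajectory[OF x])
  obtain \<delta> L where \<delta>: "\<delta> > 0" and L: "L \<ge> 0"
    and gL: "\<And>a c. a \<in> K \<Longrightarrow> dist a c < \<delta> \<Longrightarrow> dist (g a) (g c) \<le> L * dist a c"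
    using lipschitz_near_compact[OF K lip] by metis
  obtain R where R: "\<And>a. a \<in> K \<Longrightarrow> norm a \<le> R"
    using compact_imp_bounded[OF K] by (auto simp: bounded_iff)
  have unif: "uniform_limit (cball 0 (R + \<delta>)) G g sequentially"
    using G by (auto simp: C0b_tendsto_def)
  show ?thesis
    unfolding uniform_limit_iff
  proof (intro allI impI)
    fix \<epsilon> :: real assume "\<epsilon> > 0"
    define \<rho> where "\<rho> = min \<epsilon> \<delta>"
    have \<rho>: "\<rho> > 0" "\<rho> \<le> \<epsilon>" "\<rho> \<le> \<delta>" using \<open>\<epsilon> > 0\<close> \<delta> by (auto simp: \<rho>_def)
    \<comment> \<open>With initial distance and defect of the field below \<open>\<eta>\<close>, Gronwall's bound is exactly \<open>\<rho>\<close>.\<close>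
    define \<eta> where "\<eta> = \<rho> / ((1 + T) * exp (L * T))"
    have pos: "(1 + T) * exp (L * T) > 0" using T by (intro mult_pos_pos) auto
    have \<eta>: "\<eta> > 0" using \<rho> pos by (simp add: \<eta>_def)
    have bound: "(\<eta> + \<eta> * T) * exp (L * T) = \<rho>"
    proof -
      have "(\<eta> + \<eta> * T) * exp (L * T) = \<eta> * ((1 + T) * exp (L * T))"
        by (simp add: algebra_simps)
      also have "\<dots> = \<rho>" unfolding \<eta>_def using pos by (intro nonzero_eq_divide_eq[THEN iffD1]) auto
      finally show ?thesis .
    qed
    have "\<forall>\<^sub>F n in sequentially. dist (X0 n) x0 < \<eta>"
      using X0 \<eta> by (rule tendstoD)
    moreover have "\<forall>\<^sub>F n in sequentially. \<forall>v\<in>cball 0 (R + \<delta>). dist (G n v) (g v) < \<eta>"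
      using unif \<eta> by (auto simp: uniform_limit_iff)
    ultimately show "\<forall>\<^sub>F n in sequentially. \<forall>t\<in>{0..T}. dist (X n t) (x t) < \<epsilon>"
      using eventually_ge_at_top[of 1]
    proof eventually_elim
      fix n :: nat
      assume n: "dist (X0 n) x0 < \<eta>" "\<forall>v\<in>cball 0 (R + \<delta>). dist (G n v) (g v) < \<eta>" "1 \<le> n"
      have "norm (X n t - x t) < (\<eta> + \<eta> * T) * exp (L * T)" if t: "t \<in> {0..T}" for t
      proof (rule gronwall_norm[where u="\<lambda>t. X n t - x t" and u'="\<lambda>t. G n (X n t) - g (x t)", OF _ L _ _ _ t])
        show "((\<lambda>t. X n t - x t) has_vector_derivative G n (X n s) - g (x s)) (at s within {0..})"
          if "s \<in> {0..T}" for s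
          using X[OF n(3)] x that by (intro has_vector_derivative_diff) (auto simp: cauchy_solution_def)
        show "norm (X n 0 - x 0) < \<eta>"
          using n X[OF n(3)] x by (auto simp: cauchy_solution_def dist_norm)
        fix s assume s: "s \<in> {0..T}" and "norm (X n s - x s) < (\<eta> + \<eta> * T) * exp (L * T)"
        then have d: "dist (x s) (X n s) < \<delta>"
          using bound \<rho> by (simp add: dist_norm norm_minus_commute)
        have xs: "x s \<in> K" using s by (auto simp: K_def)
        have "norm (X n s) \<le> norm (x s) + dist (x s) (X n s)"
          by (metis dist_norm norm_triangle_sub norm_minus_commute)
        then have "X n s \<in> cball 0 (R + \<delta>)"
          using R[OF xs] d by simp
        then have "dist (G n (X n s)) (g (X n s)) < \<eta>" using n by blast
        moreover have "dist (g (x s)) (g (X n s)) \<le> L * dist (x s) (X n s)"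
          by (rule gL[OF xs d])
        moreover have "dist (G n (X n s)) (g (x s)) \<le> dist (G n (X n s)) (g (X n s)) + dist (g (x s)) (g (X n s))"
          by (rule dist_triangle2)
        ultimately show "norm (G n (X n s) - g (x s)) \<le> L * norm (X n s - x s) + \<eta>"
          by (simp add: dist_norm norm_minus_commute)
      qed (use \<eta> in auto)
      then show "\<forall>t\<in>{0..T}. dist (X n t) (x t) < \<epsilon>"
        using bound \<rho> by (force simp: dist_norm)
    qed
  qed
qed simp

lemma uniform_limit_compose_near_compact:
  fixes f :: "'a::metric_space \<Rightarrow> 'b::metric_space"
  assumes X: "uniform_limit S X x sequentially" and K: "compact (x ` S)" and f: "continuous_on UNIV f"
  shows "uniform_limit S (\<lambda>n t. f (X n t)) (\<lambda>t. f (x t)) sequentially"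
  unfolding uniform_limit_iff
proof (intro allI impI)
  fix \<epsilon> :: real assume "\<epsilon> > 0"
  obtain \<delta> where "\<delta> > 0" and \<delta>: "\<forall>a\<in>x ` S. \<forall>c. dist a c < \<delta> \<longrightarrow> dist (f a) (f c) < \<epsilon>"
    using continuous_uniform_near_compact[OF K f \<open>\<epsilon> > 0\<close>] by blast
  from X \<open>\<delta> > 0\<close> have "\<forall>\<^sub>F n in sequentially. \<forall>t\<in>S. dist (X n t) (x t) < \<delta>"
    by (auto simp: uniform_limit_iff)
  then show "\<forall>\<^sub>F n in sequentially. \<forall>t\<in>S. dist (f (X n t)) (f (x t)) < \<epsilon>"
  proof eventually_elim
    fix n assume n: "\<forall>t\<in>S. dist (X n t) (x t) < \<delta>"
    have "dist (f (x t)) (f (X n t)) < \<epsilon>" if "t \<in> S" for t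
      using n \<delta> that by (simp add: dist_commute[of "x t" "X n t"])
    then show "\<forall>t\<in>S. dist (f (X n t)) (f (x t)) < \<epsilon>"
      by (simp add: dist_commute)
  qed
qed

section \<open>Approximate solutions of a linear equation\<close>

lemma continuous_on_Icc_norm_bound:
  fixes f :: "real \<Rightarrow> 'a::real_normed_vector"
  assumes "continuous_on {a..b} f"
  shows "\<exists>M>0. \<forall>t\<in>{a..b}. norm (f t) \<le> M"
proof -
  have "bounded (f ` {a..b})"
    using assms by (intro compact_imp_bounded compact_continuous_image) auto
  then show ?thesis unfolding bounded_pos by simp
qed

text \<open>
  A residual that is at most \<open>1 + norm (u n t)\<close> merely raises the constants in the linear growth
  bound for \<open>u'\<close>, so Gronwall's estimate still applies.
\<close>
lemma approximate_solutions_bounded: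
  fixes A :: "real \<Rightarrow> 'f::real_normed_vector \<Rightarrow>\<^sub>L 'f"
  assumes u: "\<And>n t. t \<ge> 0 \<Longrightarrow> (u n has_vector_derivative u' n t) (at t within {0..})"
    and A: "continuous_on {0..T} A" and b: "continuous_on {0..T} b"
    and init: "(\<lambda>n. u n 0) \<longlonglongrightarrow> y0"
    and resid: "\<forall>\<^sub>F n in sequentially. \<forall>t\<in>{0..T}.
        norm (u' n t - (A t (u n t) + b t)) \<le> 1 + norm (u n t)"
  obtains C where "\<forall>\<^sub>F n in sequentially. \<forall>t\<in>{0..T}. norm (u n t) \<le> C"
proof -
  obtain M where M: "\<forall>t\<in>{0..T}. norm (A t) \<le> M" "M > 0"
    using continuous_on_Icc_norm_bound[OF A] by auto
  obtain N where N: "\<forall>t\<in>{0..T}. norm (b t) \<le> N" "N > 0"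
    using continuous_on_Icc_norm_bound[OF b] by auto
  define C where "C = (norm y0 + 1 + (N + 1) * T) * exp ((M + 1) * T)"
  have "\<forall>\<^sub>F n in sequentially. norm (u n 0) < norm y0 + 1"
    using tendsto_norm[OF init] by (rule order_tendstoD) simp
  with resid have "\<forall>\<^sub>F n in sequentially. \<forall>t\<in>{0..T}. norm (u n t) \<le> C"
  proof eventually_elim
    fix n
    assume n: "\<forall>t\<in>{0..T}. norm (u' n t - (A t (u n t) + b t)) \<le> 1 + norm (u n t)"
      "norm (u n 0) < norm y0 + 1"
    show "\<forall>t\<in>{0..T}. norm (u n t) \<le> C"
    proof
      fix t assume t: "t \<in> {0..T}"
      have "norm (u n t) < C"
        unfolding C_def
      proof (rule gronwall_norm[OF u _ _ n(2) _ t])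
        fix s assume s: "s \<in> {0..T}"
        have "norm (u' n s) \<le> norm (u' n s - (A s (u n s) + b s)) + (norm (A s (u n s)) + norm (b s))"
          by (smt (verit) norm_triangle_sub norm_triangle_ineq)
        also have "\<dots> \<le> (1 + norm (u n s)) + (M * norm (u n s) + N)"
          using n(1) s bspec[OF M(1) s] bspec[OF N(1) s]
          by (intro add_mono order_trans[OF norm_blinfun] mult_right_mono) auto
        finally show "norm (u' n s) \<le> (M + 1) * norm (u n s) + (N + 1)"
          by (simp add: algebra_simps)
      qed (use M N in auto)
      then show "norm (u n t) \<le> C" by simp
    qed
  qed
  then show thesis by (rule that)
qed

text \<open>
  The residual that comes from linearization is small only relative to the size of \<open>u n\<close>. Since the
  approximate solutions are bounded, it is also small absolutely.
\<close>
lemma approximate_solutions_uniform_residual: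
  fixes A :: "real \<Rightarrow> 'f::real_normed_vector \<Rightarrow>\<^sub>L 'f"
  assumes u: "\<And>n t. t \<ge> 0 \<Longrightarrow> (u n has_vector_derivative u' n t) (at t within {0..})"
    and A: "continuous_on {0..T} A" and b: "continuous_on {0..T} b"
    and init: "(\<lambda>n. u n 0) \<longlonglongrightarrow> y0"
    and resid: "\<And>\<epsilon>. \<epsilon> > 0 \<Longrightarrow> \<forall>\<^sub>F n in sequentially. \<forall>t\<in>{0..T}.
        norm (u' n t - (A t (u n t) + b t)) \<le> \<epsilon> * (1 + norm (u n t))"
    and \<epsilon>: "\<epsilon> > 0"
  shows "\<forall>\<^sub>F n in sequentially. \<forall>t\<in>{0..T}. norm (u' n t - (A t (u n t) + b t)) \<le> \<epsilon>"
proof -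
  obtain C where C: "\<forall>\<^sub>F n in sequentially. \<forall>t\<in>{0..T}. norm (u n t) \<le> C"
    using approximate_solutions_bounded[OF u A b init] resid[of 1] by auto
  define D where "D = max C 0"
  have "\<epsilon> / (1 + D) > 0" using \<epsilon> by (simp add: D_def)
  from C resid[OF this] show ?thesis
  proof eventually_elim
    fix n
    assume n: "\<forall>t\<in>{0..T}. norm (u n t) \<le> C"
      "\<forall>t\<in>{0..T}. norm (u' n t - (A t (u n t) + b t)) \<le> \<epsilon> / (1 + D) * (1 + norm (u n t))"
    show "\<forall>t\<in>{0..T}. norm (u' n t - (A t (u n t) + b t)) \<le> \<epsilon>"
    proof
      fix t assume t: "t \<in> {0..T}"
      have "norm (u' n t - (A t (u n t) + b t)) \<le> \<epsilon> / (1 + D) * (1 + norm (u n t))"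
        using n t by blast
      also have "\<dots> \<le> \<epsilon> / (1 + D) * (1 + D)"
        using n t \<epsilon> by (intro mult_left_mono) (auto simp: D_def le_max_iff_disj)
      also have "\<dots> = \<epsilon>" by (simp add: D_def)
      finally show "norm (u' n t - (A t (u n t) + b t)) \<le> \<epsilon>" .
    qed
  qed
qed

text \<open>
  The inhomogeneity cancels in the difference of two approximate solutions, which therefore solves
  the homogeneous equation up to the sum of the two residuals; Gronwall's estimate bounds it by these
  residuals and by the initial difference.
\<close>
lemma approximate_solutions_Cauchy:
  fixes A :: "real \<Rightarrow> 'f::real_normed_vector \<Rightarrow>\<^sub>L 'f"
  assumes u: "\<And>n t. t \<ge> 0 \<Longrightarrow> (u n has_vector_derivative u' n t) (at t within {0..})"
    and A: "continuous_on {0..T} A"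
    and init: "Cauchy (\<lambda>n. u n 0)"
    and resid: "\<And>\<epsilon>. \<epsilon> > 0 \<Longrightarrow> \<forall>\<^sub>F n in sequentially. \<forall>t\<in>{0..T}.
        norm (u' n t - (A t (u n t) + b t)) \<le> \<epsilon>"
  shows "uniformly_Cauchy_on {0..T} u"
proof (cases "T \<ge> 0")
  case T: True
  obtain M where M: "\<forall>t\<in>{0..T}. norm (A t) \<le> M" "M > 0"
    using continuous_on_Icc_norm_bound[OF A] by auto
  show ?thesis
  proof (rule uniformly_Cauchy_onI)
    fix \<epsilon> :: real assume "\<epsilon> > 0"
    have pos: "(1 + 2 * T) * exp (M * T) > 0" using T by (intro mult_pos_pos) auto
    \<comment> \<open>Initial difference \<open>\<eta>\<close> and residual \<open>2 * \<eta>\<close> make Gronwall's bound equal to \<open>\<epsilon>\<close>.\<close>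
    define \<eta> where "\<eta> = \<epsilon> / ((1 + 2 * T) * exp (M * T))"
    have \<eta>: "\<eta> > 0" using \<open>\<epsilon> > 0\<close> pos by (simp add: \<eta>_def)
    have bound: "(\<eta> + (2 * \<eta>) * T) * exp (M * T) = \<epsilon>"
    proof -
      have "(\<eta> + (2 * \<eta>) * T) * exp (M * T) = \<eta> * ((1 + 2 * T) * exp (M * T))"
        by (simp add: algebra_simps)
      also have "\<dots> = \<epsilon>" unfolding \<eta>_def using pos by (intro nonzero_eq_divide_eq[THEN iffD1]) auto
      finally show ?thesis .
    qed
    obtain N1 where N1: "\<And>m n. m \<ge> N1 \<Longrightarrow> n \<ge> N1 \<Longrightarrow> dist (u m 0) (u n 0) < \<eta>"
      using init \<eta> unfolding Cauchy_def by metis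
    obtain N2 where N2: "\<And>n t. n \<ge> N2 \<Longrightarrow> t \<in> {0..T} \<Longrightarrow> norm (u' n t - (A t (u n t) + b t)) \<le> \<eta>"
      using resid[OF \<eta>] unfolding eventually_sequentially by metis
    have "dist (u m t) (u n t) < \<epsilon>" if t: "t \<in> {0..T}" and mn: "m \<ge> max N1 N2" "n \<ge> max N1 N2" for t m n
    proof -
      have "norm (u m t - u n t) < (\<eta> + (2 * \<eta>) * T) * exp (M * T)"
      proof (rule gronwall_norm[where u="\<lambda>t. u m t - u n t" and u'="\<lambda>t. u' m t - u' n t", OF _ _ _ _ _ t])
        show "((\<lambda>t. u m t - u n t) has_vector_derivative u' m s - u' n s) (at s within {0..})"
          if "s \<in> {0..T}" for s
          using that by (intro has_vector_derivative_diff u) auto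
        show "norm (u m 0 - u n 0) < \<eta>"
          using N1 mn by (auto simp: dist_norm)
        fix s assume s: "s \<in> {0..T}"
        let ?r = "\<lambda>n. u' n s - (A s (u n s) + b s)"
        have "u' m s - u' n s = A s (u m s - u n s) + (?r m - ?r n)"
          by (simp add: blinfun.diff_right)
        then have "norm (u' m s - u' n s) \<le> norm (A s (u m s - u n s)) + (norm (?r m) + norm (?r n))"
          by (smt (verit) norm_triangle_ineq norm_triangle_ineq4)
        also have "\<dots> \<le> M * norm (u m s - u n s) + (\<eta> + \<eta>)"
          using bspec[OF M(1) s] N2[OF _ s] mn
          by (intro add_mono order_trans[OF norm_blinfun] mult_right_mono) auto
        finally show "norm (u' m s - u' n s) \<le> M * norm (u m s - u n s) + 2 * \<eta>"
          by simp
      qed (use M \<eta> in auto)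
      then show ?thesis by (simp add: bound dist_norm)
    qed
    then show "\<exists>M. \<forall>x\<in>{0..T}. \<forall>m\<ge>M. \<forall>n\<ge>M. dist (u m x) (u n x) < \<epsilon>"
      by blast
  qed
qed (auto simp: uniformly_Cauchy_on_def)

text \<open>
  On every bounded time interval the \<open>u n\<close> converge uniformly because they are uniformly Cauchy, and
  then so do the derivatives, each being \<open>A t (u n t) + b t\<close> up to the residual. The theorem on
  the derivative of a limit identifies the limit as a solution. In this way the existence of a
  solution follows from the existence of approximate ones.
\<close>
proposition approximate_solutions_converge:
  fixes A :: "real \<Rightarrow> 'f::banach \<Rightarrow>\<^sub>L 'f"
  assumes u: "\<And>n t. t \<ge> 0 \<Longrightarrow> (u n has_vector_derivative u' n t) (at t within {0..})"
    and A: "continuous_on {0..} A" and b: "continuous_on {0..} b"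
    and init: "(\<lambda>n. u n 0) \<longlonglongrightarrow> y0"
    and resid: "\<And>T \<epsilon>. \<epsilon> > 0 \<Longrightarrow> \<forall>\<^sub>F n in sequentially. \<forall>t\<in>{0..T}.
        norm (u' n t - (A t (u n t) + b t)) \<le> \<epsilon> * (1 + norm (u n t))"
  shows "\<exists>y. cauchy_solution (\<lambda>t z. A t z + b t) y0 y \<and>
    (\<forall>T. uniform_limit {0..T} u y sequentially) \<and>
    (\<forall>T. uniform_limit {0..T} u' (\<lambda>t. A t (y t) + b t) sequentially)"
proof -
  have AT: "continuous_on {0..T} A" and bT: "continuous_on {0..T} b" for T
    using A b by (auto intro: continuous_on_subset)
  note resid' = approximate_solutions_uniform_residual[OF u AT bT init resid]
  define y where "y = (\<lambda>t. lim (\<lambda>n. u n t))"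
  have lim_u: "uniform_limit {0..T} u y sequentially" for T
    using approximate_solutions_Cauchy[OF u AT LIMSEQ_imp_Cauchy[OF init] resid', where T=T]
    unfolding y_def uniformly_convergent_uniform_limit_iff[symmetric] uniformly_convergent_eq_Cauchy by simp
  have lim_u': "uniform_limit {0..T} u' (\<lambda>t. A t (y t) + b t) sequentially" for T
    unfolding uniform_limit_iff
  proof (intro allI impI)
    fix \<epsilon> :: real assume \<epsilon>: "\<epsilon> > 0"
    obtain M where M: "\<forall>t\<in>{0..T}. norm (A t) \<le> M" "M > 0"
      using continuous_on_Icc_norm_bound[OF AT[of T]] by auto
    have "\<forall>\<^sub>F n in sequentially. \<forall>t\<in>{0..T}. dist (u n t) (y t) < \<epsilon> / (2 * M)"
      using lim_u[of T] M \<epsilon> by (auto simp: uniform_limit_iff)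
    moreover have "\<forall>\<^sub>F n in sequentially. \<forall>t\<in>{0..T}. norm (u' n t - (A t (u n t) + b t)) \<le> \<epsilon> / 2"
      using \<epsilon> by (intro resid') auto
    ultimately show "\<forall>\<^sub>F n in sequentially. \<forall>t\<in>{0..T}. dist (u' n t) (A t (y t) + b t) < \<epsilon>"
    proof eventually_elim
      fix n
      assume n: "\<forall>t\<in>{0..T}. dist (u n t) (y t) < \<epsilon> / (2 * M)"
        "\<forall>t\<in>{0..T}. norm (u' n t - (A t (u n t) + b t)) \<le> \<epsilon> / 2"
      show "\<forall>t\<in>{0..T}. dist (u' n t) (A t (y t) + b t) < \<epsilon>"
      proof
        fix t assume t: "t \<in> {0..T}"
        have "norm (A t (u n t - y t)) \<le> M * norm (u n t - y t)"
          using bspec[OF M(1) t] by (intro order_trans[OF norm_blinfun] mult_right_mono) auto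
        also have "\<dots> < M * (\<epsilon> / (2 * M))"
          using n t M(2) by (intro mult_strict_left_mono) (auto simp: dist_norm)
        also have "\<dots> = \<epsilon> / 2" using M(2) by simp
        finally have "norm (A t (u n t - y t)) < \<epsilon> / 2" .
        moreover have "u' n t - (A t (y t) + b t) = (u' n t - (A t (u n t) + b t)) + A t (u n t - y t)"
          by (simp add: blinfun.diff_right)
        then have "dist (u' n t) (A t (y t) + b t)
            \<le> norm (u' n t - (A t (u n t) + b t)) + norm (A t (u n t - y t))"
          by (metis dist_norm norm_triangle_ineq)
        moreover have "norm (u' n t - (A t (u n t) + b t)) \<le> \<epsilon> / 2"
          using n t by blast
        ultimately show "dist (u' n t) (A t (y t) + b t) < \<epsilon>" by linarith
      qed
    qed
  qed
  \<comment> \<open>The derivative at \<open>t\<close> is read off on \<open>{0..t + 1}\<close>, a neighbourhood of \<open>t\<close> in the half-line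
    on which the convergence is uniform.\<close>
  have "(y has_vector_derivative A t (y t) + b t) (at t within {0..})" if t: "t \<ge> 0" for t
  proof -
    let ?S = "{0..t + 1}"
    have "\<exists>w. \<forall>s\<in>?S. (\<lambda>n. u n s) \<longlonglongrightarrow> w s \<and>
        (w has_derivative (\<lambda>h. h *\<^sub>R (A s (y s) + b s))) (at s within ?S)"
    proof (rule has_derivative_sequence[where f=u and f'="\<lambda>n s h. h *\<^sub>R u' n s" and ?x0.0=0, OF _ _ _ _ init])
      fix n s assume "s \<in> ?S"
      then show "(u n has_derivative (\<lambda>h. h *\<^sub>R u' n s)) (at s within ?S)"
        using has_vector_derivative_within_subset[OF u, of s ?S n] by (auto simp: has_vector_derivative_def)
    next
      fix \<epsilon> :: real assume "\<epsilon> > 0"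
      then have "\<forall>\<^sub>F n in sequentially. \<forall>s\<in>?S. dist (u' n s) (A s (y s) + b s) < \<epsilon>"
        using lim_u'[of "t + 1"] by (auto simp: uniform_limit_iff)
      then show "\<forall>\<^sub>F n in sequentially. \<forall>s\<in>?S. \<forall>h.
          norm (h *\<^sub>R u' n s - h *\<^sub>R (A s (y s) + b s)) \<le> \<epsilon> * norm h"
      proof eventually_elim
        fix n
        assume n: "\<forall>s\<in>?S. dist (u' n s) (A s (y s) + b s) < \<epsilon>"
        have "norm (h *\<^sub>R u' n s - h *\<^sub>R (A s (y s) + b s)) \<le> \<epsilon> * norm h" if "s \<in> ?S" for s h
        proof -
          have "norm (u' n s - (A s (y s) + b s)) \<le> \<epsilon>"
            using n that by (auto simp: dist_norm intro: less_imp_le)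
          then have "\<bar>h\<bar> * norm (u' n s - (A s (y s) + b s)) \<le> \<bar>h\<bar> * \<epsilon>"
            by (rule mult_left_mono) simp
          then show ?thesis
            by (simp only: flip: scaleR_diff_right) (simp add: mult.commute)
        qed
        then show "\<forall>s\<in>?S. \<forall>h. norm (h *\<^sub>R u' n s - h *\<^sub>R (A s (y s) + b s)) \<le> \<epsilon> * norm h"
          by blast
      qed
    qed (use t in auto)
    then obtain w where w: "\<forall>s\<in>?S. (\<lambda>n. u n s) \<longlonglongrightarrow> w s \<and>
        (w has_derivative (\<lambda>h. h *\<^sub>R (A s (y s) + b s))) (at s within ?S)"
      by blast
    have eq: "w s = y s" if "s \<in> ?S" for s
      using bspec[OF w that] unfolding y_def by (auto dest: limI)
    have "(w has_vector_derivative A t (y t) + b t) (at t within ?S)"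
      using w t by (auto simp: has_vector_derivative_def)
    then have "(y has_vector_derivative A t (y t) + b t) (at t within ?S)"
      by (rule has_vector_derivative_transform[rotated 2]) (use t eq in auto)
    moreover have "at t within ?S = at t within {0..}"
      by (rule at_within_nhd[where S="{..<t + 1}"]) auto
    ultimately show ?thesis by simp
  qed
  moreover have "y 0 = y0"
    using init by (simp add: y_def limI)
  ultimately have "cauchy_solution (\<lambda>t z. A t z + b t) y0 y"
    by (simp add: cauchy_solution_def)
  then show ?thesis using lim_u lim_u' by blast
qed

text \<open>
  The difference of two solutions starts at \<open>0\<close>, so every \<open>r > 0\<close> may serve as the strict bound on
  the initial value in Gronwall's estimate, which thereby becomes arbitrarily small.
\<close>
lemma linear_cauchy_problem_unique:
  fixes A :: "real \<Rightarrow> 'f::real_normed_vector \<Rightarrow>\<^sub>L 'f"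
  assumes A: "continuous_on {0..} A"
    and y: "cauchy_solution (\<lambda>t z. A t z + b t) y0 y"
    and w: "cauchy_solution (\<lambda>t z. A t z + b t) y0 w"
    and t: "t \<ge> 0"
  shows "w t = y t"
proof -
  obtain M where M: "\<forall>s\<in>{0..t}. norm (A s) \<le> M" "M > 0"
    using continuous_on_Icc_norm_bound[OF continuous_on_subset[OF A], of 0 t] by auto
  have "norm (w t - y t) \<le> \<epsilon>" if "\<epsilon> > 0" for \<epsilon>
  proof -
    have "norm (w t - y t) < (\<epsilon> / exp (M * t) + 0 * t) * exp (M * t)"
    proof (rule gronwall_norm[where u="\<lambda>t. w t - y t" and u'="\<lambda>t. (A t (w t) + b t) - (A t (y t) + b t)"])
      show "((\<lambda>t. w t - y t) has_vector_derivative (A s (w s) + b s) - (A s (y s) + b s)) (at s within {0..})"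
        if "s \<in> {0..t}" for s
        using that y w by (intro has_vector_derivative_diff) (auto simp: cauchy_solution_def)
      show "norm (A s (w s) + b s - (A s (y s) + b s)) \<le> M * norm (w s - y s) + 0"
        if "s \<in> {0..t}" for s
      proof -
        have "A s (w s) + b s - (A s (y s) + b s) = A s (w s - y s)"
          by (simp add: blinfun.diff_right)
        then show ?thesis
          using bspec[OF M(1) that] by (auto intro!: order_trans[OF norm_blinfun] mult_right_mono)
      qed
    qed (use y w M t that in \<open>auto simp: cauchy_solution_def\<close>)
    then show ?thesis by simp
  qed
  then have "norm (w t - y t) \<le> 0" by (rule field_le_epsilon) auto
  then show ?thesis by simp
qed

section \<open>Operators and derivatives with respect to the weaker norm\<close>

lemma dense_inclusion_bounded_linear:
  assumes "dense_inclusion j"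
  shows "bounded_linear j"
  using assms unfolding dense_inclusion_def
  by (intro bounded_linear_intro[where K=1]) (auto simp: linear_add linear_scale)

lemma dense_inclusion_closed_induct:
  assumes j: "dense_inclusion j" and "closed S" and "\<And>v. j v \<in> S"
  shows "w \<in> S"
proof -
  have "closure (range j) \<subseteq> S"
    using assms by (intro closure_minimal) auto
  then show ?thesis using j by (auto simp: dense_inclusion_def)
qed

lemma norm_blinfun_le_dense:
  fixes M :: "'f::real_normed_vector \<Rightarrow>\<^sub>L 'f"
  assumes j: "dense_inclusion j" and K: "0 \<le> K" "\<And>v. norm (M (j v)) \<le> K * norm (j v)"
  shows "norm M \<le> K"
proof (rule norm_blinfun_bound[OF K(1)])
  fix w
  have "closed {w. norm (M w) \<le> K * norm w}"
    by (intro closed_Collect_le continuous_intros)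
  then have "w \<in> {w. norm (M w) \<le> K * norm w}"
    by (rule dense_inclusion_closed_induct[OF j]) (simp add: K)
  then show "norm (M w) \<le> K * norm w" by simp
qed

text \<open>
  On \<open>range j\<close> the operator becomes \<open>w \<mapsto> j (T (inv j w))\<close>, which is Lipschitz for the norm of
  the larger space and so extends continuously to the closure of \<open>range j\<close>. Linearity passes to the
  extension by density, for additivity in one argument at a time.
\<close>
lemma bounded_linear_wrt_extends:
  fixes j :: "'e::real_normed_vector \<Rightarrow> 'f::banach"
  assumes j: "dense_inclusion j" and T: "bounded_linear_wrt j T"
  obtains L :: "'f \<Rightarrow>\<^sub>L 'f" where "\<And>v. L (j v) = j (T v)"
proof -
  interpret j: bounded_linear j by (rule dense_inclusion_bounded_linear[OF j])
  have injj: "inj j" using j by (simp add: dense_inclusion_def)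
  have linT: "linear T" using T by (simp add: bounded_linear_wrt_def)
  obtain K' where K': "\<And>v. norm (j (T v)) \<le> norm (j v) * K'"
    using T by (auto simp: bounded_linear_wrt_def)
  define K where "K = max K' 0"
  have K: "norm (j (T v)) \<le> K * norm (j v)" for v
    using K'[of v] mult_left_mono[of K' K "norm (j v)"] by (simp add: K_def mult.commute)
  define f where "f = (\<lambda>w. j (T (inv j w)))"
  have f: "f (j v) = j (T v)" for v
    by (simp add: f_def inv_f_f[OF injj])
  have "K-lipschitz_on (range j) f"
  proof (rule lipschitz_onI)
    fix p q assume "p \<in> range j" "q \<in> range j"
    then obtain v w where "p = j v" "q = j w" by auto
    then show "dist (f p) (f q) \<le> K * dist p q"
      using K[of "v - w"] by (simp add: f dist_norm linear_diff[OF linT] j.diff)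
  qed (simp add: K_def)
  then obtain L where L: "K-lipschitz_on (closure (range j)) L" "\<And>w. w \<in> range j \<Longrightarrow> L w = f w"
    using lipschitz_extend_closure by metis
  have Lj: "L (j v) = j (T v)" for v using L(2) f by simp
  have lip: "K-lipschitz_on UNIV L" using L(1) j by (simp add: dense_inclusion_def)
  then have cL: "continuous_on UNIV L" by (rule lipschitz_on_continuous_on)
  have cL': "continuous_on UNIV (\<lambda>w. L (h w))" if "continuous_on UNIV h" for h :: "'f \<Rightarrow> 'f"
    using continuous_on_compose2[OF cL that] by simp
  have add_j: "L (w + j v) = L w + L (j v)" for v w
  proof -
    have "closed {w. L (w + j v) = L w + L (j v)}"
      by (intro closed_Collect_eq continuous_intros cL')
    then have "w \<in> {w. L (w + j v) = L w + L (j v)}"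
      by (rule dense_inclusion_closed_induct[OF j])
        (simp add: Lj flip: j.add linear_add[OF linT])
    then show ?thesis by simp
  qed
  have add: "L (p + q) = L p + L q" for p q
  proof -
    have "closed {q. L (p + q) = L p + L q}"
      by (intro closed_Collect_eq continuous_intros cL')
    then have "q \<in> {q. L (p + q) = L p + L q}"
      by (rule dense_inclusion_closed_induct[OF j]) (simp add: add_j)
    then show ?thesis by simp
  qed
  have scale: "L (c *\<^sub>R p) = c *\<^sub>R L p" for c p
  proof -
    have "closed {p. L (c *\<^sub>R p) = c *\<^sub>R L p}"
      by (intro closed_Collect_eq continuous_intros cL')
    then have "p \<in> {p. L (c *\<^sub>R p) = c *\<^sub>R L p}"
      by (rule dense_inclusion_closed_induct[OF j])
        (simp add: Lj linear_scale[OF linT] flip: j.scaleR)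
    then show ?thesis by simp
  qed
  have "L 0 = 0" using scale[of 0 0] by simp
  then have bl: "bounded_linear L"
    using add scale lipschitz_onD[OF lip, of _ 0]
    by (intro bounded_linear_intro[where K=K]) (auto simp: mult.commute)
  show thesis
    by (rule that[of "Blinfun L"]) (simp add: bounded_linear_Blinfun_apply[OF bl] Lj)
qed

lemma extension_wrt_eq:
  fixes L :: "'f::real_normed_vector \<Rightarrow>\<^sub>L 'f"
  assumes j: "dense_inclusion j" and L: "\<And>v. L (j v) = j (T v)"
  shows "extension_wrt j T = blinfun_apply L"
  unfolding extension_wrt_def
proof (rule the_equality)
  show "bounded_linear (blinfun_apply L) \<and> (\<forall>v. L (j v) = j (T v))"
    using L by (simp add: blinfun.bounded_linear_right)
  fix L' assume L': "bounded_linear L' \<and> (\<forall>v. L' (j v) = j (T v))"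
  show "L' = blinfun_apply L"
  proof
    fix w
    have "continuous_on UNIV L'"
      using L' by (simp add: linear_continuous_on)
    then have "closed {w. L' w = L w}"
      by (intro closed_Collect_eq continuous_intros)
    then have "w \<in> {w. L' w = L w}"
      by (rule dense_inclusion_closed_induct[OF j]) (use L L' in simp)
    then show "L' w = L w" by simp
  qed
qed

lemma bounded_linear_wrt_diff:
  assumes j: "linear j" and "bounded_linear_wrt j S" "bounded_linear_wrt j T"
  shows "bounded_linear_wrt j (\<lambda>v. S v - T v)"
proof -
  from assms obtain K L where K: "\<And>v. norm (j (S v)) \<le> norm (j v) * K"
    and L: "\<And>v. norm (j (T v)) \<le> norm (j v) * L"
    by (auto simp: bounded_linear_wrt_def)
  have "norm (j (S v - T v)) \<le> norm (j v) * (K + L)" for v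
    using norm_triangle_ineq4[of "j (S v)" "j (T v)"] K[of v] L[of v]
    by (simp add: linear_diff[OF j] algebra_simps)
  then show ?thesis
    using assms by (auto simp: bounded_linear_wrt_def intro!: linear_compose_sub)
qed

text \<open>
  The supremum that defines \<open>onorm_wrt\<close> is taken in the reals and says something only if the
  quotients are bounded above, which is what \<open>bounded_linear_wrt\<close> provides. At \<open>v = 0\<close> the quotient
  is \<open>0 / 0 = 0\<close>, and this makes the supremum nonnegative.
\<close>
lemma onorm_wrt_bound:
  assumes j: "linear j" and T: "bounded_linear_wrt j T"
  shows "norm (j (T v)) \<le> onorm_wrt j T * norm (j v)" "0 \<le> onorm_wrt j T"
proof -
  obtain K where K: "\<And>v. norm (j (T v)) \<le> norm (j v) * K"
    using T by (auto simp: bounded_linear_wrt_def)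
  have "norm (j (T v)) / norm (j v) \<le> max K 0" for v
    using K[of v] by (cases "j v = 0") (auto simp: divide_simps mult.commute le_max_iff_disj)
  then have bdd: "bdd_above (range (\<lambda>v. norm (j (T v)) / norm (j v)))"
    by (intro bdd_aboveI2)
  have le: "norm (j (T v)) / norm (j v) \<le> onorm_wrt j T" for v
    unfolding onorm_wrt_def by (rule cSUP_upper[OF _ bdd]) simp
  show "0 \<le> onorm_wrt j T"
    using le[of 0] by (simp add: linear_0[OF j])
  show "norm (j (T v)) \<le> onorm_wrt j T * norm (j v)"
    using le[of v] K[of v] by (cases "j v = 0") (auto simp: divide_simps)
qed

text \<open>
  Extending an operator does not increase its norm, by density; so the extended derivative inherits
  the continuity of \<open>x \<mapsto> d\<^sub>x g\<close> in the operator norm.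
\<close>
lemma C1_wrt_extended_derivative:
  fixes j :: "'e::real_normed_vector \<Rightarrow> 'f::banach"
  assumes j: "dense_inclusion j" and g: "g \<in> C1_wrt j"
  obtains D :: "'e \<Rightarrow> 'f \<Rightarrow>\<^sub>L 'f"
  where "\<And>x v. D x (j v) = j (frechet_derivative g (at x) v)" "continuous_on UNIV D"
proof -
  have lin: "linear j" using j by (simp add: dense_inclusion_def)
  have bl: "bounded_linear_wrt j (frechet_derivative g (at x))" for x
    using g by (auto simp: C1_wrt_def)
  have "\<forall>x. \<exists>L::'f \<Rightarrow>\<^sub>L 'f. \<forall>v. L (j v) = j (frechet_derivative g (at x) v)"
    using bounded_linear_wrt_extends[OF j bl] by metis
  then obtain D :: "'e \<Rightarrow> 'f \<Rightarrow>\<^sub>L 'f" where D: "\<And>x v. D x (j v) = j (frechet_derivative g (at x) v)"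
    by metis
  have le: "norm (D z - D x) \<le> onorm_wrt j (\<lambda>v. frechet_derivative g (at z) v - frechet_derivative g (at x) v)"
    for x z
    using onorm_wrt_bound[OF lin bounded_linear_wrt_diff[OF lin bl bl]]
    by (intro norm_blinfun_le_dense[OF j]) (auto simp: blinfun.diff_left D linear_diff[OF lin])
  have "(D \<longlongrightarrow> D x) (at x)" for x
  proof -
    have "((\<lambda>z. onorm_wrt j (\<lambda>v. frechet_derivative g (at z) v - frechet_derivative g (at x) v)) \<longlongrightarrow> 0) (at x)"
      using g by (auto simp: C1_wrt_def)
    then have "((\<lambda>z. D z - D x) \<longlongrightarrow> 0) (at x)"
      by (rule Lim_null_comparison[rotated]) (simp add: le)
    then show ?thesis by (rule LIM_zero_cancel)
  qed
  then show thesis using D by (intro that) (auto simp: continuous_on_def)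
qed

text \<open>
  Along the segment from \<open>a\<close> to \<open>b\<close> the curve \<open>\<theta> \<mapsto> j (g (a + \<theta> *\<^sub>R (b - a)))\<close> has velocity
  \<open>D c (j (b - a))\<close>, which involves the increment only through \<open>j\<close>. The mean value inequality thus
  bounds the remainder by the weaker norm of \<open>b - a\<close>, although \<open>g\<close> is differentiable only for the
  stronger norm.
\<close>
lemma taylor_remainder_wrt:
  fixes j :: "'e::real_normed_vector \<Rightarrow> 'f::real_normed_vector" and D :: "'e \<Rightarrow> 'f \<Rightarrow>\<^sub>L 'f"
  assumes j: "bounded_linear j"
    and g: "\<And>c. c \<in> closed_segment a b \<Longrightarrow> (g has_derivative g' c) (at c)"
    and D: "\<And>c v. D c (j v) = j (g' c v)"
    and B: "\<And>c. c \<in> closed_segment a b \<Longrightarrow> norm (D c - D a) \<le> B"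
  shows "norm (j (g b - g a) - D a (j (b - a))) \<le> B * norm (j (b - a))"
proof -
  interpret j: bounded_linear j by fact
  define p where "p = (\<lambda>\<theta>. a + \<theta> *\<^sub>R (b - a))"
  have seg: "p \<theta> \<in> closed_segment a b" if "\<theta> \<in> {0..1}" for \<theta>
    using that by (auto simp: p_def closed_segment_def algebra_simps intro!: exI[of _ \<theta>])
  have "norm (j (g (p 1)) - j (g (p 0)) - (1 - 0) *\<^sub>R D (p 0) (j (b - a)))
      \<le> norm (1 - 0 :: real) * (B * norm (j (b - a)))"
  proof (rule vector_differentiable_bound_linearization[where S="{0..1}" and f="\<lambda>\<theta>. j (g (p \<theta>))"
        and f'="\<lambda>\<theta>. D (p \<theta>) (j (b - a))" and ?x0.0=0])
    fix \<theta> :: real assume \<theta>: "\<theta> \<in> {0..1}"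
    have p: "(p has_vector_derivative b - a) (at \<theta> within {0..1})"
      unfolding p_def by (auto intro!: derivative_eq_intros)
    have "(g has_derivative g' (p \<theta>)) (at (p \<theta>) within p ` {0..1})"
      using g[OF seg[OF \<theta>]] by (rule has_derivative_at_withinI)
    with p have "(g \<circ> p has_vector_derivative g' (p \<theta>) (b - a)) (at \<theta> within {0..1})"
      by (rule vector_derivative_diff_chain_within)
    then show "((\<lambda>\<theta>. j (g (p \<theta>))) has_vector_derivative D (p \<theta>) (j (b - a))) (at \<theta> within {0..1})"
      using j.has_vector_derivative[of "g \<circ> p"] by (simp add: D)
    have "norm ((D (p \<theta>) - D a) (j (b - a))) \<le> B * norm (j (b - a))"
      by (intro order_trans[OF norm_blinfun] mult_right_mono B seg \<theta>) auto
    then show "norm (D (p \<theta>) (j (b - a)) - D (p 0) (j (b - a))) \<le> B * norm (j (b - a))"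
      by (simp add: blinfun.diff_left p_def)
  qed (auto simp: closed_segment_eq_real_ivl)
  then show ?thesis by (simp add: p_def j.diff)
qed

section \<open>Continuously differentiable functions on the half-line\<close>

lemma vector_derivative_within_halfline:
  assumes "t \<ge> 0" "(u has_vector_derivative u') (at t within {0..})"
  shows "vector_derivative u (at t within {0..}) = u'"
proof (rule vector_derivative_within[OF _ assms(2)])
  have "at t within {0..t+1} \<noteq> bot" using assms(1) by (simp add: trivial_limit_within islimpt_Icc)
  then show "at t within {0..} \<noteq> bot"
    by (metis Icc_subset_Ici_iff assms(1) at_le bot.extremum_uniqueI order_refl)
qed

lemma C1_halflineI:
  assumes u: "\<And>t. t \<ge> 0 \<Longrightarrow> (u has_vector_derivative u' t) (at t within {0..})"
    and u': "continuous_on {0..} u'"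
  shows "u \<in> C1_halfline"
proof -
  have "continuous_on {0..} (\<lambda>t. vector_derivative u (at t within {0..}))"
    using u' by (rule continuous_on_eq) (simp add: vector_derivative_within_halfline[OF _ u])
  then show ?thesis
    using u unfolding C1_halfline_def
    by (auto simp: differentiable_on_def intro: differentiableI_vector)
qed

lemma C1_tendstoI:
  assumes U: "\<And>n t. t \<ge> 0 \<Longrightarrow> (U n has_vector_derivative U' n t) (at t within {0..})"
    and u: "\<And>t. t \<ge> 0 \<Longrightarrow> (u has_vector_derivative u' t) (at t within {0..})"
    and lim: "\<And>T. uniform_limit {0..T} U u sequentially" "\<And>T. uniform_limit {0..T} U' u' sequentially"
  shows "C1_tendsto U u"
  unfolding C1_tendsto_def
proof (intro allI impI)
  fix B :: "real set" assume B: "bounded B \<and> B \<subseteq> {0..}"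
  then obtain T where T: "\<And>t. t \<in> B \<Longrightarrow> norm t \<le> T" by (auto simp: bounded_iff)
  have sub: "B \<subseteq> {0..T}" using B T by force
  have "uniform_limit B U' u' sequentially"
    using lim(2) sub by (rule uniform_limit_on_subset)
  also have "?this \<longleftrightarrow> uniform_limit B (\<lambda>n t. vector_derivative (U n) (at t within {0..}))
       (\<lambda>t. vector_derivative u (at t within {0..})) sequentially"
    using B by (intro uniform_limit_cong') (auto simp: vector_derivative_within_halfline[OF _ U] vector_derivative_within_halfline[OF _ u] subset_iff)
  finally show "uniform_limit B U u sequentially \<and>
     uniform_limit B (\<lambda>n t. vector_derivative (U n) (at t within {0..}))
       (\<lambda>t. vector_derivative u (at t within {0..})) sequentially"
    using uniform_limit_on_subset[OF lim(1) sub] by simp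
qed

theorem proposition2p2:
  fixes j :: "'e::banach \<Rightarrow> 'f::banach"
    and X0 :: "nat \<Rightarrow> 'e" and G :: "nat \<Rightarrow> 'e \<Rightarrow> 'e" and X :: "nat \<Rightarrow> real \<Rightarrow> 'e"
    and x0 :: 'e and g :: "'e \<Rightarrow> 'e" and x :: "real \<Rightarrow> 'e"
    and y0 :: 'f and h :: "'e \<Rightarrow> 'f"
  assumes "\<And>n. n \<ge> 1 \<Longrightarrow> G n \<in> C0b"
    and "\<And>n. n \<ge> 1 \<Longrightarrow> complete_vector_field (G n)"
    and "\<And>n. n \<ge> 1 \<Longrightarrow> unique_cauchy_solution (\<lambda>_. G n) (X0 n) (X n)"
    and "X0 \<longlonglongrightarrow> x0"
    and "g \<in> C0b"
    and "C0b_tendsto G g"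
    and "complete_vector_field g"
    and "unique_cauchy_solution (\<lambda>_. g) x0 x"
    and "dense_inclusion j"
    and "g \<in> C1_wrt j"
    and "(\<lambda>n. sqrt (real n) *\<^sub>R j (X0 n - x0)) \<longlonglongrightarrow> y0"
    and "h \<in> C0b"
    and "C0b_tendsto (\<lambda>n v. sqrt (real n) *\<^sub>R j (G n v - g v)) h"
  shows "\<exists>y. unique_cauchy_solution
               (\<lambda>t z. extension_wrt j (frechet_derivative g (at (x t))) z + h (x t)) y0 y \<and>
             y \<in> C1_halfline \<and>
             (\<forall>n\<ge>1. (\<lambda>t. sqrt (real n) *\<^sub>R j (X n t - x t)) \<in> C1_halfline) \<and>
             C1_tendsto (\<lambda>n t. sqrt (real n) *\<^sub>R j (X n t - x t)) y"
proof -
  let ?Y = "\<lambda>n t. sqrt (real n) *\<^sub>R j (X n t - x t)"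
  let ?Y' = "\<lambda>n t. sqrt (real n) *\<^sub>R j (G n (X n t) - g (x t))"
  note j = assms(9)
  interpret j: bounded_linear j by (rule dense_inclusion_bounded_linear[OF j])
  have X: "cauchy_solution (\<lambda>_. G n) (X0 n) (X n)" if "n \<ge> 1" for n
    using assms(3)[OF that] by (simp add: unique_cauchy_solution_def)
  have x: "cauchy_solution (\<lambda>_. g) x0 x"
    using assms(8) by (simp add: unique_cauchy_solution_def)
  note cx = cauchy_solution_continuous_on[OF x]
  have cg: "continuous_on UNIV g" and ch: "continuous_on UNIV h"
    using assms(5,12) by (auto simp: C0b_def)
  have dg: "(g has_derivative frechet_derivative g (at c)) (at c)" for c
    using assms(10) by (simp add: C1_wrt_def frechet_derivative_works[symmetric])
  obtain D :: "'e \<Rightarrow> 'f \<Rightarrow>\<^sub>L 'f"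
    where D: "\<And>c v. D c (j v) = j (frechet_derivative g (at c) v)" and cD: "continuous_on UNIV D"
    using C1_wrt_extended_derivative[OF j assms(10)] by metis
  have ext: "extension_wrt j (frechet_derivative g (at c)) = blinfun_apply (D c)" for c
    using extension_wrt_eq[OF j, of "D c" "frechet_derivative g (at c)"] D by blast
  have lim_X: "uniform_limit {0..T} X x sequentially" for T
    using flow_depends_continuously_on_field[where G=G and g=g and ?X0.0=X0 and X=X and x=x, OF X x assms(4,6)] assms(7)
    by (simp add: complete_vector_field_def)

  \<comment> \<open>At \<open>n = 0\<close> the factor \<open>sqrt (real n)\<close> vanishes, so the formula holds for every index.\<close>
  have dY: "(?Y n has_vector_derivative ?Y' n t) (at t within {0..})" if "t \<ge> 0" for n t
  proof (cases "n = 0")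
    case False
    then have "((\<lambda>t. X n t - x t) has_vector_derivative G n (X n t) - g (x t)) (at t within {0..})"
      using X[of n] x that by (intro has_vector_derivative_diff) (auto simp: cauchy_solution_def)
    moreover have "bounded_linear (\<lambda>v. sqrt (real n) *\<^sub>R j v)"
      by (rule bounded_linear_const_scaleR[OF j.bounded_linear_axioms])
    ultimately show ?thesis
      by (rule bounded_linear.has_vector_derivative[rotated])
  qed simp
  have initY: "(\<lambda>n. ?Y n 0) \<longlonglongrightarrow> y0"
  proof (rule Lim_transform_eventually[OF assms(11)])
    show "\<forall>\<^sub>F n in sequentially. sqrt (real n) *\<^sub>R j (X0 n - x0) = ?Y n 0"
      using eventually_ge_at_top[of 1]
      by eventually_elim (use X x in \<open>auto simp: cauchy_solution_def\<close>)
  qed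
  have cDx: "continuous_on {0..} (\<lambda>t. D (x t))" and chx: "continuous_on {0..} (\<lambda>t. h (x t))"
    using continuous_on_compose2[OF cD cx] continuous_on_compose2[OF ch cx] by auto

  \<comment> \<open>Linearization: the residual in the limit equation splits into the defect \<open>p\<close> of the rescaled
    fields, the variation \<open>q\<close> of \<open>h\<close> between the two trajectories, and the Taylor remainder \<open>r\<close>.\<close>
  have resid: "\<forall>\<^sub>F n in sequentially. \<forall>t\<in>{0..T}.
      norm (?Y' n t - (D (x t) (?Y n t) + h (x t))) \<le> \<epsilon> * (1 + norm (?Y n t))" if \<epsilon>: "\<epsilon> > 0" for T \<epsilon>
  proof -
    have K: "compact (x ` {0..T})" by (rule cauchy_solution_compact_trajectory[OF x])
    obtain \<delta> where \<delta>: "\<delta> > 0"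
      and D\<delta>: "\<forall>a\<in>x ` {0..T}. \<forall>c. dist a c < \<delta> \<longrightarrow> dist (D a) (D c) < \<epsilon>"
      using continuous_uniform_near_compact[OF K cD \<epsilon>] by blast
    obtain R where R: "\<forall>t\<in>{0..T}. norm (x t) \<le> R"
      using compact_imp_bounded[OF K] unfolding bounded_iff by blast
    \<comment> \<open>A bounded set that contains \<open>X n t\<close> as soon as \<open>X n t\<close> is within \<open>\<delta>\<close> of \<open>x t\<close>.\<close>
    have "uniform_limit (cball 0 (R + \<delta>)) (\<lambda>n v. sqrt (real n) *\<^sub>R j (G n v - g v)) h sequentially"
      using assms(13) by (simp add: C0b_tendsto_def)
    then have "\<forall>\<^sub>F n in sequentially. \<forall>v\<in>cball 0 (R + \<delta>).
        dist (sqrt (real n) *\<^sub>R j (G n v - g v)) (h v) < \<epsilon> / 2"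
      by (rule uniform_limitD) (use \<epsilon> in simp)
    moreover have "\<forall>\<^sub>F n in sequentially. \<forall>t\<in>{0..T}. dist (h (X n t)) (h (x t)) < \<epsilon> / 2"
      by (rule uniform_limitD[OF uniform_limit_compose_near_compact[OF lim_X K ch]]) (use \<epsilon> in simp)
    moreover have "\<forall>\<^sub>F n in sequentially. \<forall>t\<in>{0..T}. dist (X n t) (x t) < \<delta>"
      by (rule uniform_limitD[OF lim_X \<delta>])
    ultimately show ?thesis
    proof eventually_elim
      fix n
      assume Gh: "\<forall>v\<in>cball 0 (R + \<delta>). dist (sqrt (real n) *\<^sub>R j (G n v - g v)) (h v) < \<epsilon> / 2"
        and hX: "\<forall>t\<in>{0..T}. dist (h (X n t)) (h (x t)) < \<epsilon> / 2"
        and Xx: "\<forall>t\<in>{0..T}. dist (X n t) (x t) < \<delta>"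
      show "\<forall>t\<in>{0..T}. norm (?Y' n t - (D (x t) (?Y n t) + h (x t))) \<le> \<epsilon> * (1 + norm (?Y n t))"
      proof
        fix t assume t: "t \<in> {0..T}"
        define p where "p = sqrt (real n) *\<^sub>R j (G n (X n t) - g (X n t)) - h (X n t)"
        define q where "q = h (X n t) - h (x t)"
        define r where "r = j (g (X n t) - g (x t)) - D (x t) (j (X n t - x t))"
        have "norm (X n t) \<le> norm (x t) + dist (X n t) (x t)"
          by (metis dist_norm norm_triangle_sub)
        then have "X n t \<in> cball 0 (R + \<delta>)"
          using bspec[OF R t] bspec[OF Xx t] by simp
        then have p: "norm p \<le> \<epsilon> / 2"
          using bspec[OF Gh] by (simp add: p_def dist_norm less_imp_le)
        have q: "norm q \<le> \<epsilon> / 2"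
          using bspec[OF hX t] by (simp add: q_def dist_norm)
        have "norm r \<le> \<epsilon> * norm (j (X n t - x t))"
          unfolding r_def
        proof (rule taylor_remainder_wrt[where g'="\<lambda>c. frechet_derivative g (at c)"])
          show "(g has_derivative frechet_derivative g (at c)) (at c)" for c
            by (rule dg)
          show "D c (j v) = j (frechet_derivative g (at c) v)" for c v
            by (rule D)
          fix c assume "c \<in> closed_segment (x t) (X n t)"
          then have "dist (x t) c \<le> dist (X n t) (x t)"
            using segment_bound1[of c "x t" "X n t"] by (simp add: dist_norm norm_minus_commute)
          then have "dist (x t) c < \<delta>"
            using bspec[OF Xx t] by simp
          then have "dist (D (x t)) (D c) < \<epsilon>"
            using D\<delta> t by blast
          then show "norm (D c - D (x t)) \<le> \<epsilon>"
            by (simp add: dist_norm norm_minus_commute)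
        qed (rule j.bounded_linear_axioms)
        then have r: "norm (sqrt (real n) *\<^sub>R r) \<le> \<epsilon> * norm (?Y n t)"
          using mult_left_mono[of "norm r" "\<epsilon> * norm (j (X n t - x t))" "sqrt (real n)"]
          by (simp add: mult.left_commute)
        have "?Y' n t - (D (x t) (?Y n t) + h (x t)) = p + q + sqrt (real n) *\<^sub>R r"
          by (simp add: p_def q_def r_def blinfun.scaleR_right blinfun.diff_right j.diff algebra_simps)
        then have "norm (?Y' n t - (D (x t) (?Y n t) + h (x t))) \<le> norm p + norm q + norm (sqrt (real n) *\<^sub>R r)"
          using norm_triangle_ineq[of "p + q" "sqrt (real n) *\<^sub>R r"] norm_triangle_ineq[of p q] by simp
        also have "\<dots> \<le> \<epsilon> * (1 + norm (?Y n t))"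
          using p q r by (simp add: distrib_left)
        finally show "norm (?Y' n t - (D (x t) (?Y n t) + h (x t))) \<le> \<epsilon> * (1 + norm (?Y n t))" .
      qed
    qed
  qed

  obtain y where y: "cauchy_solution (\<lambda>t z. D (x t) z + h (x t)) y0 y"
    and lim_Y: "\<forall>T. uniform_limit {0..T} ?Y y sequentially"
    and lim_Y': "\<forall>T. uniform_limit {0..T} ?Y' (\<lambda>t. D (x t) (y t) + h (x t)) sequentially"
    using approximate_solutions_converge[where u="?Y" and u'="?Y'"
        and A="\<lambda>t. D (x t)" and b="\<lambda>t. h (x t)", OF dY cDx chx initY resid] by blast
  have dy: "(y has_vector_derivative D (x t) (y t) + h (x t)) (at t within {0..})" if "t \<ge> 0" for t
    using y that by (simp add: cauchy_solution_def)
  have "unique_cauchy_solution (\<lambda>t z. D (x t) z + h (x t)) y0 y"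
    using y linear_cauchy_problem_unique[OF cDx y] by (auto simp: unique_cauchy_solution_def)
  moreover have "y \<in> C1_halfline"
    using cauchy_solution_continuous_on[OF y] cDx chx
    by (intro C1_halflineI[OF dy] continuous_intros) auto
  moreover have "?Y n \<in> C1_halfline" if "n \<ge> 1" for n
  proof (rule C1_halflineI[OF dY])
    have "continuous_on UNIV (G n)" using assms(1)[OF that] by (simp add: C0b_def)
    then show "continuous_on {0..} (?Y' n)"
      using cauchy_solution_continuous_on[OF X[OF that]] cx cg
      by (intro continuous_intros j.continuous_on)
        (auto intro: continuous_on_compose2)
  qed
  moreover have "C1_tendsto ?Y y"
    by (rule C1_tendstoI[OF dY dy lim_Y[rule_format] lim_Y'[rule_format]])
  ultimately show ?thesis
    unfolding ext by blast
qed

end
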